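(* If $(X,\tau)$ is a KC-space, then $(X,\tau)$ is a strong R-space.
   Context: "Compact" means that every open cover has a finite subcover (no separation assumed). A topological space is a KC-space if all of its compact subsets are closed. A set is saturated if it is an intersection of open sets; $\mathcal{Q}(X)$ denotes the set of all compact saturated subsets of $X$. A $T_0$ space $(X,\tau)$ is a strong R-space if for each family $\mathcal{K}\subseteq\mathcal{Q}(X)$ and each $U\in\tau$, $\bigcap\mathcal{K}\subseteq U$ implies that $\bigcap\mathcal{F}\subseteq U$ for some finite subfamily $\mathcal{F}\subseteq\mathcal{K}$ (the intersection of the empty family being $X$). *)

theory Defs
  imports "HOL-Analysis.Analysis"
begin

text \<open>
  Intersections are taken inside \<open>topspace X\<close>, so that the intersection of the empty family
  is the whole space.
\<close>

definition saturatedin :: "'a topology \<Rightarrow> 'a set \<Rightarrow> bool" where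
  "saturatedin X S \<longleftrightarrow> (\<exists>\<U>. (\<forall>U\<in>\<U>. openin X U) \<and> S = topspace X \<inter> \<Inter>\<U>)"

definition compact_saturated_sets :: "'a topology \<Rightarrow> 'a set set" where
  "compact_saturated_sets X = {K. compactin X K \<and> saturatedin X K}"

definition strong_R_space :: "'a topology \<Rightarrow> bool" where
  "strong_R_space X \<longleftrightarrow>
     t0_space X \<and>
     (\<forall>\<K> U. \<K> \<subseteq> compact_saturated_sets X \<and> openin X U \<and> topspace X \<inter> \<Inter>\<K> \<subseteq> U \<longrightarrow>
        (\<exists>\<F>. finite \<F> \<and> \<F> \<subseteq> \<K> \<and> topspace X \<inter> \<Inter>\<F> \<subseteq> U))"

end

theory Submission
  imports Defs
begin

text \<open>In a KC-space the members of \<open>\<K>\<close> are closed as well as compact. Fix one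
  of them, \<open>K\<close>: the part of \<open>K\<close> outside \<open>U\<close> is compact and
  misses \<open>\<Inter>\<K>\<close>, so by the finite intersection property
  (\<open>compactin_fip\<close>) it already misses a finite subintersection. Singletons are compact,
  hence closed, which gives T1 and so T0.\<close>

theorem proposition3p1:
  fixes X :: "'a topology"
  assumes "kc_space X"
  shows "strong_R_space X"
  unfolding strong_R_space_def
proof (intro conjI allI impI)
  show "t0_space X"
    using assms by (simp add: kc_imp_t1_space t1_imp_t0_space)
next
  fix \<K> U
  assume "\<K> \<subseteq> compact_saturated_sets X \<and> openin X U \<and> topspace X \<inter> \<Inter>\<K> \<subseteq> U"
  then have comp: "\<And>K. K \<in> \<K> \<Longrightarrow> compactin X K" and U: "openin X U"
    and sub: "topspace X \<inter> \<Inter>\<K> \<subseteq> U"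
    by (auto simp: compact_saturated_sets_def)
  have closed: "\<forall>K\<in>\<K>. closedin X K"
    using assms comp by (auto simp: kc_space_def)
  show "\<exists>\<F>. finite \<F> \<and> \<F> \<subseteq> \<K> \<and> topspace X \<inter> \<Inter>\<F> \<subseteq> U"
  proof (cases "\<K> = {}")
    \<comment> \<open>With no \<open>K\<close> to supply compactness, the hypothesis itself reads
      \<open>topspace X \<subseteq> U\<close>, and the empty subfamily works.\<close>
    case True
    then show ?thesis using sub by auto
  next
    case False
    then obtain K where K: "K \<in> \<K>" by blast
    have "compactin X ((topspace X - U) \<inter> K)"
      using U comp[OF K] by (intro closed_Int_compactin) auto
    moreover have "((topspace X - U) \<inter> K) \<inter> \<Inter>\<K> = {}"
      using sub by blast
    ultimately obtain \<F> where "finite \<F>" "\<F> \<subseteq> \<K>" "((topspace X - U) \<inter> K) \<inter> \<Inter>\<F> = {}"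
      using closed unfolding compactin_fip by meson
    \<comment> \<open>\<open>\<F>\<close> excludes only the points outside \<open>U\<close> that lie
      in \<open>K\<close>; adjoining \<open>K\<close> excludes the rest.\<close>
    then have "finite (insert K \<F>) \<and> insert K \<F> \<subseteq> \<K> \<and> topspace X \<inter> \<Inter>(insert K \<F>) \<subseteq> U"
      using K by auto
    then show ?thesis by blast
  qed
qed

end
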